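(* For all integers $n$ and $k$ with $n\ge 2k$, $$\min(n-2k+2,\lfloor n/2\rfloor)\le \chi(U(n,k))\le \min(n-2k+2,\lceil n/2\rceil).$$
   Context: For integers $n$ and $k$ with $n\ge 2k$, $U(n,k)$ is the graph whose vertices are the $k$-subsets of $[n]=\{1,\ldots,n\}$ that include a pair of elements that are consecutive modulo $n$ (i.e., contain $\{j,j+1\}$ for some $1\le j<n$, or contain $\{1,n\}$), with two sets adjacent if and only if they are disjoint. $\chi(G)$ denotes the chromatic number of a graph $G$.
   Formalization: The formal statement assumes in addition k ≥ 2; for k ≤ 1 and n ≥ 2 the graph U(n,k) has no vertices, so its chromatic number is 0 and the stated lower bound fails (e.g. n = 2, k = 1). *)

theory Defs
  imports Complex_Main "Graph_Theory.Pair_Digraph"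
begin

definition proper_coloring :: "'a pair_pre_digraph \<Rightarrow> nat \<Rightarrow> ('a \<Rightarrow> nat) \<Rightarrow> bool" where
  "proper_coloring G c f \<longleftrightarrow>
     f ` pverts G \<subseteq> {..<c} \<and> (\<forall>(u, v) \<in> parcs G. f u \<noteq> f v)"

text \<open>The \<open>LEAST\<close> is attained for every finite loop-free graph, in particular for every
  \<open>pair_graph\<close>; the graph without vertices has chromatic number \<open>0\<close>.\<close>

definition chromatic_number :: "'a pair_pre_digraph \<Rightarrow> nat" where
  "chromatic_number G = (LEAST c. \<exists>f. proper_coloring G c f)"

definition has_cyclically_consecutive_pair :: "nat \<Rightarrow> nat set \<Rightarrow> bool" where
  "has_cyclically_consecutive_pair n A \<longleftrightarrow>
     (\<exists>j. 1 \<le> j \<and> j < n \<and> {j, j + 1} \<subseteq> A) \<or> {1, n} \<subseteq> A"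

text \<open>An undirected graph is a symmetric set of arcs; \<open>parcs\<close> contains both orientations of
  each edge.\<close>

definition U_graph :: "nat \<Rightarrow> nat \<Rightarrow> nat set pair_pre_digraph" where
  "U_graph n k =
     (let V = {A. A \<subseteq> {1..n} \<and> card A = k \<and> has_cyclically_consecutive_pair n A}
      in \<lparr> pverts = V, parcs = {(A, B). A \<in> V \<and> B \<in> V \<and> A \<inter> B = {}} \<rparr>)"

lemma pair_graph_U_graph: "pair_graph (U_graph n k)"
proof -
  let ?V = "pverts (U_graph n k)"
  have arcs: "parcs (U_graph n k) = {(A, B). A \<in> ?V \<and> B \<in> ?V \<and> A \<inter> B = {}}"
    by (simp add: U_graph_def)
  have fin: "finite ?V"
    by (rule finite_subset[of _ "Pow {1..n}"]) (auto simp: U_graph_def)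
  have ne: "A \<noteq> {}" if "A \<in> ?V" for A
    using that by (auto simp: U_graph_def has_cyclically_consecutive_pair_def)
  have "finite (parcs (U_graph n k))"
    by (rule finite_subset[of _ "?V \<times> ?V"]) (use fin in \<open>auto simp: arcs\<close>)
  then show ?thesis
    using fin ne by unfold_locales (auto simp: arcs symmetric_def sym_def)
qed

lemma chromatic_number_attained:
  assumes "pair_graph G"
  shows "\<exists>f. proper_coloring G (chromatic_number G) f"
proof -
  interpret pair_graph G by (rule assms)
  obtain f where f: "bij_betw f (pverts G) {..<card (pverts G)}"
    using ex_bij_betw_finite_nat[OF pair_finite_verts] by (auto simp: lessThan_atLeast0)
  have "proper_coloring G (card (pverts G)) f"
    unfolding proper_coloring_def
  proof (intro conjI ballI, goal_cases)
    case 1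
    then show ?case using f by (auto simp: bij_betw_def)
  next
    case (2 e)
    then have "fst e \<in> pverts G" "snd e \<in> pverts G" "fst e \<noteq> snd e"
      using arc_fst_in_verts arc_snd_in_verts pair_no_loops by blast+
    then show ?case using f by (auto simp: bij_betw_def inj_on_def split_beta)
  qed
  then have "\<exists>f. proper_coloring G (card (pverts G)) f" by blast
  then show ?thesis unfolding chromatic_number_def by (rule LeastI)
qed

end

theory Submission
  imports Defs
begin

text \<open>For the lower bound let M = max(2k - 2, \<lceil>n/2\<rceil>), so that the minimum in question is n - M. Given
  a colouring with c colours, we label the nonzero sign vectors X on n coordinates, viewed as pairs
  of disjoint sets, with \<open>\<pm>1, \<dots>, \<pm>(M + c)\<close> such that the hypotheses of the octahedral Tucker lemma
  hold; it yields n \<open>\<le>\<close> M + c. If one of the two sets contains a vertex, use M + 1 + i for the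
  smallest colour i that occurs. Otherwise flip the signs at odd positions and use the number of
  alternations. It is at most \<lceil>n/2\<rceil> if neither set contains consecutive elements, and at most
  2k - 2 if both do, because they then have fewer than k elements each. If exactly one of them does
  and the number of alternations is at least M, use the label M with the sign of that set. This
  does not clash with a smaller X having M alternations and no consecutive elements: such an X is so
  rigid that one prescribed side has at least k - 1 elements.

  Tucker's lemma is proved by Fan's parity argument, counting the full flags whose labels alternate
  in sign.\<close>

section \<open>Alternating sets of signed integers\<close>

text \<open>Ordered by absolute value, the signs alternate, starting with a positive one iff \<open>s\<close>.\<close>
definition alternating :: "bool \<Rightarrow> int set \<Rightarrow> bool" where
  "alternating s S \<longleftrightarrow> (\<forall>x\<in>S. (0 < x) = (s = even (card {y \<in> S. \<bar>y\<bar> < \<bar>x\<bar>})))"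

lemma alternating_empty [simp]: "alternating s {}"
  by (simp add: alternating_def)

lemma alternating_not_both:
  assumes "S \<noteq> {}" and "alternating s S"
  shows "\<not> alternating (\<not> s) S"
  using assms by (auto simp: alternating_def)

lemma alternating_insert_max:
  assumes "\<And>y. y \<in> S \<Longrightarrow> \<bar>y\<bar> < \<bar>x\<bar>"
  shows "alternating s (insert x S) \<longleftrightarrow> alternating s S \<and> (0 < x) = (s = even (card S))"
proof -
  have 1: "{y \<in> insert x S. \<bar>y\<bar> < \<bar>x\<bar>} = S"
    using assms by auto
  have 2: "{y \<in> insert x S. \<bar>y\<bar> < \<bar>z\<bar>} = {y \<in> S. \<bar>y\<bar> < \<bar>z\<bar>}" if "z \<in> S" for z
    using assms[OF that] by auto
  show ?thesis
    unfolding alternating_def ball_simps 1 using 2 by auto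
qed

text \<open>Every old rank goes up by one, which reverses the pattern of signs.\<close>

lemma alternating_insert_min:
  assumes "finite S" and "alternating s S" and "\<And>y. y \<in> S \<Longrightarrow> \<bar>x\<bar> < \<bar>y\<bar>"
    and "(0 < x) = (\<not> s)"
  shows "alternating (\<not> s) (insert x S)"
proof -
  have 1: "{y \<in> insert x S. \<bar>y\<bar> < \<bar>x\<bar>} = {}"
    using assms(3) by force
  have 2: "{y \<in> insert x S. \<bar>y\<bar> < \<bar>z\<bar>} = insert x {y \<in> S. \<bar>y\<bar> < \<bar>z\<bar>}" if "z \<in> S" for z
    using assms(3)[OF that] by auto
  have 3: "card (insert x {y \<in> S. \<bar>y\<bar> < \<bar>z\<bar>}) = Suc (card {y \<in> S. \<bar>y\<bar> < \<bar>z\<bar>})" for z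
    using assms(1,3) by (subst card_insert_disjoint) auto
  show ?thesis
    unfolding alternating_def ball_simps 1 using 2 3 assms(2,4) by (auto simp: alternating_def)
qed

lemma alternating_uminus:
  assumes "0 \<notin> S"
  shows "alternating s (uminus ` S) \<longleftrightarrow> alternating (\<not> s) S"
proof -
  have "{y \<in> uminus ` S. \<bar>y\<bar> < \<bar>- z\<bar>} = uminus ` {y \<in> S. \<bar>y\<bar> < \<bar>z\<bar>}" for z
    by auto
  then have "card {y \<in> uminus ` S. \<bar>y\<bar> < \<bar>- z\<bar>} = card {y \<in> S. \<bar>y\<bar> < \<bar>z\<bar>}" for z
    by (simp add: card_image)
  moreover have "(0 < - z) = (\<not> 0 < z)" if "z \<in> S" for z
    using assms that by (metis neg_0_less_iff_less linorder_cases less_asym neg_less_0_iff_less)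
  ultimately show ?thesis
    unfolding alternating_def by auto
qed

text \<open>Such sets encode sign vectors: i or -i in the set gives the sign of coordinate i, and
  neither means 0. Being its own antipode, 0 is excluded. Inclusion is the usual order of sign
  vectors.\<close>

definition antipode_free :: "int set \<Rightarrow> bool" where
  "antipode_free X \<longleftrightarrow> (\<forall>x\<in>X. - x \<notin> X)"

lemma antipode_free_subset: "antipode_free Y \<Longrightarrow> X \<subseteq> Y \<Longrightarrow> antipode_free X"
  by (auto simp: antipode_free_def)

lemma antipode_free_zero: "antipode_free X \<Longrightarrow> 0 \<notin> X"
  by (metis antipode_free_def minus_zero)

lemma antipode_free_uminus [simp]: "antipode_free (uminus ` X) \<longleftrightarrow> antipode_free X"
  by (auto simp: antipode_free_def)

lemma antipode_free_inj_abs: "antipode_free X \<Longrightarrow> inj_on abs X"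
  by (auto simp: antipode_free_def inj_on_def abs_eq_iff)

section \<open>Parity of the alternating facets of a labelled simplex\<close>

text \<open>Induction on the element x of largest absolute value. Deleting x counts iff the rest S
  alternates positively; deleting another y counts only if x has the sign that fits on top, and then
  the induction hypothesis counts these y. If x fits, the positive case cancels modulo 2 and a
  negatively alternating S remains, which x prolongs; otherwise x prolongs a positively alternating
  S.\<close>

lemma odd_card_alternating_faces:
  assumes "finite S" "S \<noteq> {}" "antipode_free S"
  shows "odd (card {x \<in> S. alternating True (S - {x})}) \<longleftrightarrow> alternating True S \<or> alternating False S"
  using assms
proof (induction S rule: finite_ranking_induct[where f = abs])
  case empty
  then show ?case by simp
next
  case (insert x S)
  show ?case
  proof (cases "x \<in> S")
    case True
    then show ?thesis
      using insert.IH insert.prems by (auto simp: insert_absorb)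
  next
    case xS: False
    have max: "\<bar>y\<bar> < \<bar>x\<bar>" if "y \<in> S" for y
    proof -
      have "y \<noteq> x" "y \<noteq> - x" "\<bar>y\<bar> \<le> \<bar>x\<bar>"
        using insert.hyps(2)[OF that] insert.prems(2) that xS by (auto simp: antipode_free_def)
      then show ?thesis by linarith
    qed
    show ?thesis
    proof (cases "S = {}")
      case True
      have "{y. y = x \<and> alternating True ({x} - {y})} = {x}" by auto
      then show ?thesis using True by (auto simp: alternating_def)
    next
      case False
      let ?A = "{y \<in> S. alternating True (S - {y})}"
      let ?B = "{y \<in> S. alternating True (S - {y}) \<and> (0 < x) = odd (card S)}"
      have IH: "odd (card ?A) \<longleftrightarrow> alternating True S \<or> alternating False S"
        using insert False antipode_free_subset by blast
      have B: "alternating True (insert x S - {y}) \<longleftrightarrow>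
          alternating True (S - {y}) \<and> (0 < x) = odd (card S)" if "y \<in> S" for y
      proof -
        have "insert x S - {y} = insert x (S - {y})"
          using that xS by auto
        moreover have "even (card (S - {y})) = odd (card S)"
          using card.remove[OF \<open>finite S\<close> that] by simp
        ultimately show ?thesis
          using alternating_insert_max[of "S - {y}" x True] max by simp
      qed
      have eq: "{y \<in> insert x S. alternating True (insert x S - {y})} =
          (if alternating True S then {x} else {}) \<union> ?B"
        using B xS by (auto simp: insert_absorb)
      have "card {y \<in> insert x S. alternating True (insert x S - {y})} =
          of_bool (alternating True S) + card ?B"
        unfolding eq using xS insert.hyps(1) by (subst card_Un_disjoint) auto
      moreover have "card ?B = of_bool ((0 < x) = odd (card S)) * card ?A"
        by auto
      ultimately show ?thesis
        using IH max alternating_not_both[OF False, of True]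
        by (auto simp: alternating_insert_max)
    qed
  qed
qed

text \<open>Here labels may repeat. If exactly one is lost, through f i = f j, then only deleting i
  or j leaves distinct labels, and both facets carry the same label set, so the count is 0 or 2. If
  more are lost, the count is 0.\<close>

lemma odd_card_alternating_index_faces:
  fixes f :: "'i \<Rightarrow> int"
  assumes I: "finite I" "I \<noteq> {}" and af: "antipode_free (f ` I)"
  shows "odd (card {i \<in> I. alternating True (f ` (I - {i})) \<and> card (f ` (I - {i})) = card I - 1})
    \<longleftrightarrow> (alternating True (f ` I) \<or> alternating False (f ` I)) \<and> card (f ` I) = card I"
    (is "odd (card ?A) \<longleftrightarrow> _")
proof (cases "inj_on f I")
  case True
  have D: "f ` (I - {i}) = f ` I - {f i}" if "i \<in> I" for i
    using True that by (auto simp: inj_on_def)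
  have A: "?A = {i \<in> I. alternating True (f ` I - {f i})}"
    using D True I by (auto simp: card_image card_Diff_singleton)
  have "f ` ?A = {x \<in> f ` I. alternating True (f ` I - {x})}"
    unfolding A by auto
  moreover have "card (f ` ?A) = card ?A"
    using True by (intro card_image) (auto simp: inj_on_def)
  ultimately show ?thesis
    using odd_card_alternating_faces[of "f ` I"] I af True by (simp add: card_image)
next
  case False
  then obtain i j where ij: "i \<in> I" "j \<in> I" "i \<noteq> j" "f i = f j"
    by (auto simp: inj_on_def)
  have ne: "card (f ` I) \<noteq> card I"
    using False I eq_card_imp_inj_on by blast
  have "f ` (I - {a}) = f ` I" if "a \<in> I" "b \<in> I" "a \<noteq> b" "f a = f b" for a b
    using that by (auto simp: image_iff)
  then have Di: "f ` (I - {i}) = f ` I" "f ` (I - {j}) = f ` I"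
    using ij by metis+
  show ?thesis
  proof (cases "card (f ` I) = card I - 1")
    case True
    have inj_i: "inj_on f (I - {i})"
      using True Di I ij by (intro eq_card_imp_inj_on) (auto simp: card_Diff_singleton)
    have inj_j: "inj_on f (I - {j})"
      using True Di I ij by (intro eq_card_imp_inj_on) (auto simp: card_Diff_singleton)
    have less: "f ` (I - {l}) \<noteq> f ` I" if "l \<in> I" "l \<noteq> i" "l \<noteq> j" for l
    proof -
      have "f l \<noteq> f x" if "x \<in> I - {l}" for x
        using inj_onD[OF inj_i, of l x] inj_onD[OF inj_j, of l x] that ij
          \<open>l \<in> I\<close> \<open>l \<noteq> i\<close> \<open>l \<noteq> j\<close> by auto
      then have "f l \<notin> f ` (I - {l})"
        by blast
      then show ?thesis using that by blast
    qed
    have other: "card (f ` (I - {l})) \<noteq> card I - 1" if "l \<in> I" "l \<noteq> i" "l \<noteq> j" for l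
    proof -
      have "f ` (I - {l}) \<subset> f ` I"
        using less[OF that] by blast
      then have "card (f ` (I - {l})) < card (f ` I)"
        using I by (intro psubset_card_mono) auto
      then show ?thesis using True by simp
    qed
    have "l \<in> ?A \<longleftrightarrow> alternating True (f ` I) \<and> l \<in> {i, j}" for l
    proof (cases "l \<in> {i, j}")
      case True
      then show ?thesis
        using Di ij \<open>card (f ` I) = card I - 1\<close> by auto
    next
      case False
      then show ?thesis using other by blast
    qed
    then have "?A = (if alternating True (f ` I) then {i, j} else {})"
      by (simp add: set_eq_iff)
    then show ?thesis
      using ne ij by auto
  next
    case neq: False
    have "card (f ` I) < card I"
      using ne I by (simp add: card_image_le order_less_le)
    then have "card (f ` (I - {l})) \<noteq> card I - 1" for l
    proof -
      have "card (f ` (I - {l})) \<le> card (f ` I)"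
        using I by (intro card_mono) auto
      then show ?thesis
        using neq \<open>card (f ` I) < card I\<close> by linarith
    qed
    then have "?A = {}" by auto
    then have "even (card ?A)" by (simp only: card.empty even_zero)
    then show ?thesis using ne by blast
  qed
qed

lemma even_card_involution:
  assumes "finite A" and "\<And>x. x \<in> A \<Longrightarrow> f x \<in> A" and "\<And>x. x \<in> A \<Longrightarrow> f (f x) = x"
    and "\<And>x. x \<in> A \<Longrightarrow> f x \<noteq> x"
  shows "even (card A)"
proof -
  let ?C = "(\<lambda>x. {x, f x}) ` A"
  have "2 * card ?C = card (\<Union> ?C)"
  proof (rule card_partition)
    fix c1 c2 assume "c1 \<in> ?C" "c2 \<in> ?C" "c1 \<noteq> c2"
    then show "c1 \<inter> c2 = {}"
      using assms(3) by (auto simp: doubleton_eq_iff) (metis)+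
  next
    fix c assume "c \<in> ?C"
    then show "card c = 2"
      using assms(4) by (auto simp: card_2_iff)
  qed (use assms in auto)
  moreover have "\<Union> ?C = A"
    using assms(2) by auto
  ultimately show ?thesis by (metis dvd_triv_left)
qed

section \<open>The octahedral Tucker lemma\<close>

text \<open>A list encodes the full flag of its nonempty prefixes, seen as signed sets.\<close>
definition signed_perms :: "nat \<Rightarrow> int list set" where
  "signed_perms d = {xs. length xs = d \<and> abs ` set xs = {1..int d}}"

definition flag_labels :: "(int set \<Rightarrow> int) \<Rightarrow> int list \<Rightarrow> nat set \<Rightarrow> int set" where
  "flag_labels l xs I = (\<lambda>j. l (set (take j xs))) ` I"

text \<open>As the labels form a set, the cardinality condition is what excludes repetitions. The
  index set \<open>{1..d}\<close> stands for the whole flag and \<open>{1..d} - {i}\<close> for a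
  ridge.\<close>

definition alternating_flag :: "(int set \<Rightarrow> int) \<Rightarrow> bool \<Rightarrow> int list \<Rightarrow> nat set \<Rightarrow> bool" where
  "alternating_flag l s xs I \<longleftrightarrow>
     alternating s (flag_labels l xs I) \<and> card (flag_labels l xs I) = card I"

lemma finite_signed_perms [simp]: "finite (signed_perms d)"
proof -
  have "signed_perms d \<subseteq> {xs. set xs \<subseteq> {- int d..int d} \<and> length xs = d}"
  proof
    fix xs assume xs: "xs \<in> signed_perms d"
    have "\<bar>x\<bar> \<le> int d" if "x \<in> set xs" for x
      using xs that by (auto simp: signed_perms_def dest!: equalityD1)
    then show "xs \<in> {xs. set xs \<subseteq> {- int d..int d} \<and> length xs = d}"
      using xs by (force simp: signed_perms_def)
  qed
  then show ?thesis
    by (rule finite_subset) (simp add: finite_lists_length_eq)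
qed

lemma signed_perms_distinct:
  assumes "xs \<in> signed_perms d"
  shows "distinct (map abs xs)"
  using assms by (intro card_distinct) (simp add: signed_perms_def)

lemma signed_perms_antipode_free:
  assumes "xs \<in> signed_perms d"
  shows "antipode_free (set xs)"
proof -
  have "inj_on abs (set xs)"
    using signed_perms_distinct[OF assms] by (simp add: distinct_map)
  moreover have "0 \<notin> set xs"
  proof
    assume "0 \<in> set xs"
    then have "0 \<in> abs ` set xs" by force
    then show False using assms by (simp add: signed_perms_def)
  qed
  ultimately show ?thesis
    by (auto simp: antipode_free_def inj_on_def) (metis abs_minus_cancel neg_equal_zero)
qed

lemma signed_perms_bound:
  assumes "xs \<in> signed_perms d"
  shows "set xs \<subseteq> {- int d..int d}"
proof
  fix x assume "x \<in> set xs"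
  then have "\<bar>x\<bar> \<in> {1..int d}"
    using assms unfolding signed_perms_def by blast
  then show "x \<in> {- int d..int d}" by auto
qed

lemma signed_perms_map_uminus:
  "map uminus xs \<in> signed_perms d \<longleftrightarrow> xs \<in> signed_perms d"
  by (simp add: signed_perms_def image_image)

section \<open>Fan's parity count of alternating flags\<close>

text \<open>The hypotheses of Tucker's lemma on the barycentric subdivision of the octahedral
  sphere, whose edges are the comparable pairs. The case X = Y of \<open>no_complementary\<close>
  makes every label nonzero.\<close>

locale antipodal_labelling =
  fixes n :: nat and l :: "int set \<Rightarrow> int"
  assumes odd_label: "\<And>X. \<lbrakk>X \<subseteq> {- int n..int n}; antipode_free X; X \<noteq> {}\<rbrakk> \<Longrightarrow> l (uminus ` X) = - l X"
    and no_complementary: "\<And>X Y. \<lbrakk>Y \<subseteq> {- int n..int n}; antipode_free Y; X \<noteq> {}; X \<subseteq> Y\<rbrakk>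
        \<Longrightarrow> l X \<noteq> - l Y"
begin

text \<open>Any two prefixes are nested, so \<open>no_complementary\<close> applies to them in one
  order or the other.\<close>

lemma antipode_free_flag_labels:
  assumes "xs \<in> signed_perms d" "d \<le> n" "I \<subseteq> {1..d}"
  shows "antipode_free (flag_labels l xs I)"
proof -
  have xs: "set xs \<subseteq> {- int n..int n}" "antipode_free (set xs)" "length xs = d"
    using signed_perms_bound[OF assms(1)] signed_perms_antipode_free[OF assms(1)] assms
    by (force simp: signed_perms_def)+
  have ordered: "l (set (take i xs)) \<noteq> - l (set (take j xs))" if "1 \<le> i" "i \<le> j" "j \<le> d" for i j
  proof (rule no_complementary)
    show "set (take j xs) \<subseteq> {- int n..int n}" "antipode_free (set (take j xs))"
      using xs set_take_subset antipode_free_subset by (metis subset_trans)+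
    show "set (take i xs) \<noteq> {}" using that xs by auto
    show "set (take i xs) \<subseteq> set (take j xs)" using that by (simp add: set_take_subset_set_take)
  qed
  have "- l (set (take i xs)) \<noteq> l (set (take j xs))" if "i \<in> I" "j \<in> I" for i j
  proof -
    have "1 \<le> i" "i \<le> d" "1 \<le> j" "j \<le> d"
      using that assms(3) by auto
    then show ?thesis
      using ordered[of i j] ordered[of j i] by (cases "i \<le> j") auto
  qed
  then show ?thesis
    unfolding antipode_free_def flag_labels_def by blast
qed

lemma odd_facets_of_flag:
  assumes "xs \<in> signed_perms d" "d \<le> n" "d > 0"
  shows "odd (card {i \<in> {1..d}. alternating_flag l True xs ({1..d} - {i})}) \<longleftrightarrow>
    alternating_flag l True xs {1..d} \<or> alternating_flag l False xs {1..d}"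
  using odd_card_alternating_index_faces[of "{1..d}" "\<lambda>j. l (set (take j xs))"]
    antipode_free_flag_labels[OF assms(1,2), of "{1..d}"] assms(3)
  by (auto simp: alternating_flag_def flag_labels_def card_Diff_singleton cong: conj_cong)

lemma alternating_flag_cong:
  assumes "\<And>j. j \<in> I \<Longrightarrow> set (take j xs) = set (take j ys)"
  shows "alternating_flag l s xs I = alternating_flag l s ys I"
proof -
  have "flag_labels l xs I = flag_labels l ys I"
    unfolding flag_labels_def using assms by (intro image_cong) auto
  then show ?thesis by (simp add: alternating_flag_def)
qed

lemma alternating_flag_uminus:
  assumes "xs \<in> signed_perms d" "d \<le> n"
  shows "alternating_flag l s (map uminus xs) {1..d} \<longleftrightarrow> alternating_flag l (\<not> s) xs {1..d}"
proof -
  have xs: "set xs \<subseteq> {- int n..int n}" "antipode_free (set xs)" "length xs = d"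
    using signed_perms_bound[OF assms(1)] signed_perms_antipode_free[OF assms(1)] assms
    by (force simp: signed_perms_def)+
  have "l (set (take j (map uminus xs))) = - l (set (take j xs))" if "j \<in> {1..d}" for j
  proof -
    have "l (uminus ` set (take j xs)) = - l (set (take j xs))"
    proof (rule odd_label)
      show "set (take j xs) \<subseteq> {- int n..int n}" "antipode_free (set (take j xs))"
        using xs set_take_subset antipode_free_subset by (metis subset_trans)+
      show "set (take j xs) \<noteq> {}" using that xs by auto
    qed
    then show ?thesis by (simp add: take_map)
  qed
  then have "flag_labels l (map uminus xs) {1..d} = uminus ` flag_labels l xs {1..d}"
    unfolding flag_labels_def image_image by (intro image_cong) auto
  moreover have "0 \<notin> flag_labels l xs {1..d}"
    using antipode_free_flag_labels[OF assms, of "{1..d}"] antipode_free_zero by blast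
  ultimately show ?thesis
    by (simp add: alternating_flag_def alternating_uminus card_image)
qed

text \<open>Swapping the entries with indices i - 1 and i, counted from 0, changes only the prefix
  of length i. This is a fixed-point-free involution that preserves the ridge.\<close>

lemma even_interior_ridges:
  assumes "d \<le> n" "i \<in> {1..<d}"
  shows "even (card {xs \<in> signed_perms d. int d \<in> set xs \<and> alternating_flag l True xs ({1..d} - {i})})"
    (is "even (card ?A)")
proof (rule even_card_involution)
  let ?f = "\<lambda>xs :: int list. xs[i - 1 := xs ! i, i := xs ! (i - 1)]"
  show "finite ?A" by simp
  fix xs assume "xs \<in> ?A"
  then have xs: "xs \<in> signed_perms d" "int d \<in> set xs" "alternating_flag l True xs ({1..d} - {i})"
    and len: "length xs = d"
    by (auto simp: signed_perms_def)
  have set: "set (?f xs) = set xs"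
    using assms len by (intro set_swap[of _ xs]) auto
  have "set (take j (?f xs)) = set (take j xs)" if "j \<noteq> i" for j
  proof (cases "j < i")
    case True
    then show ?thesis by (simp add: take_update_cancel)
  next
    case False
    then have "take j (?f xs) = (take j xs)[i - 1 := take j xs ! i, i := take j xs ! (i - 1)]"
      using that by (simp add: take_update_swap)
    also have "set \<dots> = set (take j xs)"
      using False that assms len by (intro set_swap) auto
    finally show ?thesis .
  qed
  then have "alternating_flag l True (?f xs) ({1..d} - {i})"
    using xs(3) by (subst alternating_flag_cong[of _ _ xs]) auto
  then show "?f xs \<in> ?A"
    using xs len set by (simp add: signed_perms_def)
  show "?f (?f xs) = xs"
    using assms len by (intro nth_equalityI) (auto simp: nth_list_update)
  show "?f xs \<noteq> xs"
  proof
    assume "?f xs = xs"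
    then have "xs ! i = xs ! (i - 1)"
      using assms len by (metis length_list_update nth_list_update_eq atLeastLessThan_iff)
    moreover have "distinct xs"
      using signed_perms_distinct[OF xs(1)] by (simp add: distinct_map)
    ultimately show False
      using assms len by (auto simp: nth_eq_iff_index_eq)
  qed
qed

text \<open>If the last entry is d + 1, dropping it gives an arbitrary flag of dimension d.
  Otherwise d + 1 occurs earlier and flipping the sign of the last entry pairs up the flags.\<close>

lemma boundary_ridges_parity:
  assumes "Suc d \<le> n"
  shows "even (card {xs \<in> signed_perms (Suc d). int (Suc d) \<in> set xs \<and>
        alternating_flag l True xs ({1..Suc d} - {Suc d})})
    = even (card {xs \<in> signed_perms d. alternating_flag l True xs {1..d}})"
    (is "even (card ?A) = even (card ?B)")
proof -
  let ?c = "int (Suc d)"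
  have I: "{1..Suc d} - {Suc d} = {1..d}" by auto
  have len: "length xs = Suc d" if "xs \<in> ?A" for xs
    using that by (simp add: signed_perms_def)
  have fin: "finite ?A" by simp
  have eq: "{xs \<in> ?A. last xs = ?c} = (\<lambda>ys. ys @ [?c]) ` ?B"
  proof (intro equalityI subsetI)
    fix xs assume xs: "xs \<in> {xs \<in> ?A. last xs = ?c}"
    then have l: "length xs = Suc d" "last xs = ?c" and p: "xs \<in> signed_perms (Suc d)"
      using len by auto
    define ys where "ys = butlast xs"
    have e: "xs = ys @ [?c]"
      using l unfolding ys_def by (metis append_butlast_last_id length_0_conv nat.distinct(1))
    have dist: "distinct (map abs xs)" by (rule signed_perms_distinct[OF p])
    have ly: "length ys = d" using l ys_def by simp
    have "abs ` set ys = abs ` set xs - {?c}"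
      using dist unfolding e by auto
    also have "\<dots> = {1..int d}"
      using p by (auto simp: signed_perms_def)
    finally have "ys \<in> signed_perms d" using ly by (simp add: signed_perms_def)
    moreover have "alternating_flag l True ys {1..d}"
    proof (subst alternating_flag_cong[of _ _ xs])
      show "alternating_flag l True xs {1..d}" using xs I by simp
    qed (simp add: e ly)
    ultimately show "xs \<in> (\<lambda>ys. ys @ [?c]) ` ?B" using e by blast
  next
    fix xs assume "xs \<in> (\<lambda>ys. ys @ [?c]) ` ?B"
    then obtain ys where e: "xs = ys @ [?c]" and ys: "ys \<in> signed_perms d"
      and alt: "alternating_flag l True ys {1..d}" by auto
    have ly: "length ys = d" using ys by (simp add: signed_perms_def)
    have "xs \<in> signed_perms (Suc d)"
      using ys by (auto simp: e signed_perms_def)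
    moreover have "alternating_flag l True xs {1..d}"
      using alt by (subst alternating_flag_cong[of _ _ ys]) (simp_all add: e ly)
    ultimately show "xs \<in> {xs \<in> ?A. last xs = ?c}"
      using I by (simp add: e)
  qed
  have "even (card {xs \<in> ?A. last xs \<noteq> ?c})"
  proof (rule even_card_involution)
    let ?f = "\<lambda>xs :: int list. butlast xs @ [- last xs]"
    show "finite {xs \<in> ?A. last xs \<noteq> ?c}" by simp
    fix xs assume xs: "xs \<in> {xs \<in> ?A. last xs \<noteq> ?c}"
    then have l: "length xs = Suc d" using len by auto
    define ys a where "ys = butlast xs" and "a = last xs"
    have e: "xs = ys @ [a]"
      using l unfolding ys_def a_def by (metis append_butlast_last_id length_0_conv nat.distinct(1))
    have f: "?f xs = ys @ [- a]" by (simp add: e)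
    have ly: "length ys = d" using l e by simp
    have c: "?c \<in> set ys" using xs by (auto simp: e)
    have p: "ys @ [a] \<in> signed_perms (Suc d)" using xs e by simp
    \<comment> \<open>Otherwise the flipped flag would end in d + 1 and leave the set.\<close>
    have "a \<noteq> - ?c"
      using signed_perms_distinct[OF p] c by force
    moreover have "alternating_flag l True (ys @ [- a]) {1..d}"
    proof (subst alternating_flag_cong[of _ _ xs])
      show "alternating_flag l True xs {1..d}" using xs I by simp
    qed (simp add: e ly)
    moreover have "ys @ [- a] \<in> signed_perms (Suc d)"
      using p by (simp add: signed_perms_def)
    ultimately show "?f xs \<in> {xs \<in> ?A. last xs \<noteq> ?c}"
      unfolding f using c I by auto
    show "?f (?f xs) = xs" unfolding f by (simp add: e)
    have "a \<noteq> 0"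
      using signed_perms_antipode_free[OF p] by (auto simp: antipode_free_def)
    then show "?f xs \<noteq> xs" unfolding f by (simp add: e)
  qed
  moreover have "card ?A = card {xs \<in> ?A. last xs = ?c} + card {xs \<in> ?A. last xs \<noteq> ?c}"
    using fin by (subst card_Un_disjoint[symmetric]) (auto intro!: arg_cong[of _ _ card])
  moreover have "card {xs \<in> ?A. last xs = ?c} = card ?B"
    unfolding eq by (rule card_image) (simp add: inj_on_def)
  ultimately show ?thesis by simp
qed

text \<open>Double counting of incidences between facets and positively alternating ridges in the hemisphere
  of flags containing \<open>+ (d + 1)\<close>: interior ridges lie in two facets, boundary ridges in one.\<close>
lemma odd_card_alternating_flags:
  "d \<le> n \<Longrightarrow> odd (card {xs \<in> signed_perms d. alternating_flag l True xs {1..d}})"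
proof (induction d)
  case 0
  \<comment> \<open>The empty flag alternates vacuously, which starts the count at 1.\<close>
  have "{xs \<in> signed_perms 0. alternating_flag l True xs {1..0}} = {[]}"
    by (auto simp: signed_perms_def alternating_flag_def flag_labels_def)
  then show ?case by simp
next
  case (Suc d)
  let ?D = "Suc d"
  let ?H = "{xs \<in> signed_perms ?D. int ?D \<in> set xs}"
  let ?R = "\<lambda>xs i. alternating_flag l True xs ({1..?D} - {i})"
  let ?P = "\<lambda>s xs. alternating_flag l s xs {1..?D}"
  have ex: "\<not> (?P True xs \<and> ?P False xs)" for xs
    using alternating_not_both[of "flag_labels l xs {1..?D}" True]
    by (auto simp: alternating_flag_def flag_labels_def)
  have local: "even (\<Sum>xs\<in>?H. card {i \<in> {1..?D}. ?R xs i}) \<longleftrightarrow> even (card {xs \<in> ?H. ?P True xs \<or> ?P False xs})"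
  proof -
    have "even (\<Sum>xs\<in>?H. card {i \<in> {1..?D}. ?R xs i})
        \<longleftrightarrow> even (card {xs \<in> ?H. odd (card {i \<in> {1..?D}. ?R xs i})})"
      by (rule even_sum_iff) simp
    also have "{xs \<in> ?H. odd (card {i \<in> {1..?D}. ?R xs i})} = {xs \<in> ?H. ?P True xs \<or> ?P False xs}"
      using odd_facets_of_flag[OF _ Suc.prems] by blast
    finally show ?thesis .
  qed
  have swap: "(\<Sum>xs\<in>?H. card {i \<in> {1..?D}. ?R xs i}) = (\<Sum>i\<in>{1..?D}. card {xs \<in> ?H. ?R xs i})"
    using sum.swap_restrict[of ?H "{1..?D}" "\<lambda>_ _. 1::nat" ?R] by simp
  have split: "(\<Sum>i\<in>{1..?D}. card {xs \<in> ?H. ?R xs i}) = card {xs \<in> ?H. ?R xs ?D} + (\<Sum>i\<in>{1..d}. card {xs \<in> ?H. ?R xs i})"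
    by simp
  have "even (\<Sum>i\<in>{1..d}. card {xs \<in> ?H. ?R xs i})"
    using even_interior_ridges[OF Suc.prems] by (intro dvd_sum) (simp add: conj_assoc)
  moreover have "odd (card {xs \<in> ?H. ?R xs ?D})"
    using boundary_ridges_parity[OF Suc.prems] Suc by (simp add: conj_assoc)
  ultimately have odd: "odd (card {xs \<in> ?H. ?P True xs \<or> ?P False xs})"
    using local unfolding swap split by (simp only: even_add) blast
  \<comment> \<open>Negation carries the negatively alternating flags of the hemisphere to the
    positively alternating ones outside it. Hence the flags of either sign in \<open>?H\<close> are
    as many as the positive ones on the whole sphere.\<close>
  let ?S = "{xs \<in> signed_perms ?D. int ?D \<notin> set xs \<and> ?P True xs}"
  have "bij_betw (map uminus) {xs \<in> ?H. ?P False xs} ?S"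
  proof (rule bij_betw_byWitness[where f' = "map uminus"])
    have mem: "(- int ?D \<in> set xs) = (int ?D \<notin> set xs)" if "xs \<in> signed_perms ?D" for xs
    proof -
      have "int ?D \<in> abs ` set xs"
        using that by (simp add: signed_perms_def)
      then obtain x where x: "x \<in> set xs" "\<bar>x\<bar> = int ?D"
        by (metis imageE)
      then have "x = int ?D \<or> x = - int ?D"
        by linarith
      then have "int ?D \<in> set xs \<or> - int ?D \<in> set xs"
        using x(1) by blast
      then show ?thesis
        using signed_perms_antipode_free[OF that] unfolding antipode_free_def by blast
    qed
    have mem': "a \<in> set (map uminus xs) \<longleftrightarrow> - a \<in> set xs" for a :: int and xs
      by (auto intro: rev_image_eqI)
    have key: "map uminus xs \<in> ?S \<longleftrightarrow> xs \<in> {xs \<in> ?H. ?P False xs}" for xs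
    proof (cases "xs \<in> signed_perms ?D")
      case True
      have "?P True (map uminus xs) = ?P False xs"
        using alternating_flag_uminus[OF True Suc.prems] by simp
      moreover have "(int ?D \<notin> set (map uminus xs)) = (int ?D \<in> set xs)"
        using mem[OF True] mem' by blast
      ultimately show ?thesis
        using True by (simp only: mem_Collect_eq signed_perms_map_uminus) blast
    next
      case False
      then show ?thesis
        by (simp only: mem_Collect_eq signed_perms_map_uminus) blast
    qed
    show "map uminus ` {xs \<in> ?H. ?P False xs} \<subseteq> ?S"
      using key by blast
    have "map uminus xs \<in> {xs \<in> ?H. ?P False xs}" if "xs \<in> ?S" for xs
      using key[of "map uminus xs"] that by (simp only: map_map comp_def minus_minus map_ident)
    then show "map uminus ` ?S \<subseteq> {xs \<in> ?H. ?P False xs}"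
      by blast
  qed (simp_all add: map_idI)
  then have "card {xs \<in> ?H. ?P False xs} = card ?S"
    by (rule bij_betw_same_card)
  moreover have "card {xs \<in> ?H. ?P True xs \<or> ?P False xs}
      = card {xs \<in> ?H. ?P True xs} + card {xs \<in> ?H. ?P False xs}"
    using ex by (subst card_Un_disjoint[symmetric]) (auto intro!: arg_cong[of _ _ card])
  moreover have "card {xs \<in> signed_perms ?D. ?P True xs} = card {xs \<in> ?H. ?P True xs} + card ?S"
    by (subst card_Un_disjoint[symmetric]) (auto intro!: arg_cong[of _ _ card])
  ultimately show ?case using odd by simp
qed

end

text \<open>An odd number of alternating flags is not 0. Such a flag has n distinct labels, none 0
  and no two antipodal, so their absolute values are n distinct elements of
  \<open>{1..m}\<close>.\<close>

lemma octahedral_tucker: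
  fixes l :: "int set \<Rightarrow> int"
  assumes "antipodal_labelling n l"
    and bound: "\<And>X. \<lbrakk>X \<subseteq> {- int n..int n}; antipode_free X; X \<noteq> {}\<rbrakk> \<Longrightarrow> \<bar>l X\<bar> \<le> int m"
  shows "n \<le> m"
proof -
  interpret antipodal_labelling n l by fact
  have "{xs \<in> signed_perms n. alternating_flag l True xs {1..n}} \<noteq> {}"
    using odd_card_alternating_flags[of n] by (metis card.empty even_zero order_refl)
  then obtain xs where xs: "xs \<in> signed_perms n" and card: "card (flag_labels l xs {1..n}) = n"
    by (auto simp: alternating_flag_def)
  let ?L = "flag_labels l xs {1..n}"
  have af: "antipode_free ?L"
    using antipode_free_flag_labels[OF xs] by simp
  have "\<bar>l (set (take j xs))\<bar> \<le> int m" if "j \<in> {1..n}" for j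
  proof (rule bound)
    show "set (take j xs) \<subseteq> {- int n..int n}" "antipode_free (set (take j xs))"
      using signed_perms_bound[OF xs] signed_perms_antipode_free[OF xs]
        set_take_subset antipode_free_subset by (metis subset_trans)+
    show "set (take j xs) \<noteq> {}" using that xs by (auto simp: signed_perms_def)
  qed
  then have "\<bar>x\<bar> \<in> {1..int m}" if "x \<in> ?L" for x
    using that antipode_free_zero[OF af] by (force simp: flag_labels_def)
  then have "card (abs ` ?L) \<le> card {1..int m}"
    by (intro card_mono) auto
  then show ?thesis
    using card antipode_free_inj_abs[OF af] by (simp add: card_image)
qed

section \<open>Longest alternating subsets\<close>

definition alternation_number :: "int set \<Rightarrow> nat" where
  "alternation_number Z = Max (card ` {T. T \<subseteq> Z \<and> (\<exists>s. alternating s T)})"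

text \<open>By \<open>longest_alternating_unique_sign\<close> all longest alternating subsets of a
  nonempty sign vector start alike, so this sign is well defined and changes under negation.\<close>

definition starts_positive :: "int set \<Rightarrow> bool" where
  "starts_positive Z \<longleftrightarrow> (\<exists>T \<subseteq> Z. alternating True T \<and> card T = alternation_number Z)"

lemma finite_alternating_subsets: "finite Z \<Longrightarrow> finite {T. T \<subseteq> Z \<and> (\<exists>s. alternating s T)}"
  by (rule finite_subset[of _ "Pow Z"]) auto

lemma card_le_alternation_number:
  assumes "finite Z" "T \<subseteq> Z" "alternating s T"
  shows "card T \<le> alternation_number Z"
  unfolding alternation_number_def using assms finite_alternating_subsets[OF assms(1)]
  by (intro Max_ge finite_imageI imageI) blast+

lemma alternation_number_attained:
  assumes "finite Z"
  obtains T s where "T \<subseteq> Z" "alternating s T" "card T = alternation_number Z"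
proof -
  have "{} \<in> {T. T \<subseteq> Z \<and> (\<exists>s. alternating s T)}"
    by simp
  then have "alternation_number Z \<in> card ` {T. T \<subseteq> Z \<and> (\<exists>s. alternating s T)}"
    unfolding alternation_number_def using finite_alternating_subsets[OF assms]
    by (intro Max_in finite_imageI) blast+
  then show ?thesis using that by auto
qed

lemma alternation_number_le_card:
  assumes "finite Z"
  shows "alternation_number Z \<le> card Z"
  using alternation_number_attained[OF assms] card_mono[OF assms] by metis

lemma alternation_number_pos:
  assumes "finite Z" "Z \<noteq> {}"
  shows "0 < alternation_number Z"
proof -
  obtain x where x: "x \<in> Z" using assms by auto
  have "{y \<in> {x}. \<bar>y\<bar> < \<bar>x\<bar>} = {}" by auto
  then have "alternating (0 < x) {x}"
    unfolding alternating_def ball_simps \<open>{y \<in> {x}. \<bar>y\<bar> < \<bar>x\<bar>} = {}\<close> by simp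
  then have "card {x} \<le> alternation_number Z"
    using assms x by (intro card_le_alternation_number[of Z "{x}"]) auto
  then show ?thesis by simp
qed

lemma alternation_number_uminus:
  assumes "finite Z" "antipode_free Z"
  shows "alternation_number (uminus ` Z) = alternation_number Z"
proof -
  have le: "alternation_number Y \<le> alternation_number (uminus ` Y)"
    if Y: "finite Y" "antipode_free Y" for Y
  proof -
    obtain T s where T: "T \<subseteq> Y" "alternating s T" "card T = alternation_number Y"
      using alternation_number_attained[OF Y(1)] by metis
    have "alternating (\<not> s) (uminus ` T)"
      using T Y antipode_free_zero by (subst alternating_uminus) auto
    then show ?thesis
      using card_le_alternation_number[of "uminus ` Y" "uminus ` T" "\<not> s"] T Y
      by (auto simp: card_image)
  qed
  show ?thesis
    using le[of Z] le[of "uminus ` Z"] assms by (simp add: image_image)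
qed

text \<open>A longest alternating subset cannot be extended in front, so every earlier element has the
  sign of its first element.\<close>
lemma leading_sign:
  assumes "finite Z" "T \<subseteq> Z" "alternating s T" "card T = alternation_number Z"
    and "p \<in> Z" "\<And>y. y \<in> T \<Longrightarrow> \<bar>p\<bar> < \<bar>y\<bar>"
  shows "(0 < p) = s"
proof (rule ccontr)
  assume "(0 < p) \<noteq> s"
  have fT: "finite T" using assms(1,2) finite_subset by blast
  have "alternating (\<not> s) (insert p T)"
    using fT assms \<open>(0 < p) \<noteq> s\<close> by (intro alternating_insert_min) auto
  moreover have "p \<notin> T" using assms(6) by auto
  ultimately show False
    using card_le_alternation_number[OF assms(1), of "insert p T" "\<not> s"] assms fT by auto
qed

lemma alternating_first:
  assumes "finite T" "T \<noteq> {}" "alternating s T"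
  obtains p where "p \<in> T" "(0 < p) = s" "\<And>y. y \<in> T \<Longrightarrow> \<bar>p\<bar> \<le> \<bar>y\<bar>"
proof -
  obtain p where p: "p \<in> T" "\<And>y. y \<in> T \<Longrightarrow> \<bar>p\<bar> \<le> \<bar>y\<bar>"
    using ex_min_if_finite[of "abs ` T"] assms by (metis arg_min_if_finite(1) arg_min_least)
  have "{y \<in> T. \<bar>y\<bar> < \<bar>p\<bar>} = {}"
    using p(2) by force
  then have "(0 < p) = s"
    using assms(3) p(1) unfolding alternating_def by (metis card.empty even_zero)
  then show ?thesis using that p by blast
qed

text \<open>Compare the first elements of the two subsets. The earlier one precedes the whole other
  subset, so \<open>leading_sign\<close> forces it to have the other's first sign.\<close>

lemma longest_alternating_unique_sign:
  assumes Z: "finite Z" "antipode_free Z" "Z \<noteq> {}"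
    and "T \<subseteq> Z" "alternating True T" "card T = alternation_number Z"
    and "U \<subseteq> Z" "alternating False U" "card U = alternation_number Z"
  shows False
proof -
  have fin: "finite T" "finite U" "T \<noteq> {}" "U \<noteq> {}"
    using assms alternation_number_pos[OF Z(1,3)] finite_subset by force+
  obtain p where p: "p \<in> T" "0 < p" "\<And>y. y \<in> T \<Longrightarrow> \<bar>p\<bar> \<le> \<bar>y\<bar>"
    using alternating_first[OF fin(1,3) assms(5)] by metis
  obtain q where q: "q \<in> U" "\<not> 0 < q" "\<And>y. y \<in> U \<Longrightarrow> \<bar>q\<bar> \<le> \<bar>y\<bar>"
    using alternating_first[OF fin(2,4) assms(8)] by metis
  have "\<bar>p\<bar> \<noteq> \<bar>q\<bar>"
  proof
    assume "\<bar>p\<bar> = \<bar>q\<bar>"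
    then have "p = q"
      using inj_onD[OF antipode_free_inj_abs[OF Z(2)], of p q] p(1) q(1) assms(4,7) by blast
    then show False using p(2) q(2) by simp
  qed
  then consider "\<bar>p\<bar> < \<bar>q\<bar>" | "\<bar>q\<bar> < \<bar>p\<bar>" by linarith
  then show False
  proof cases
    case 1
    then have "(0 < p) = False"
      using p(1) assms(4) q(3) by (intro leading_sign[OF Z(1) assms(7-9)]) (auto intro: less_le_trans)
    then show False using p(2) by simp
  next
    case 2
    then have "(0 < q) = True"
      using q(1) assms(7) p(3) by (intro leading_sign[OF Z(1) assms(4-6)]) (auto intro: less_le_trans)
    then show False using q(2) by simp
  qed
qed

lemma not_starts_positive_iff:
  assumes "finite Z" "antipode_free Z" "Z \<noteq> {}"
  shows "\<not> starts_positive Z \<longleftrightarrow> (\<exists>T \<subseteq> Z. alternating False T \<and> card T = alternation_number Z)"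
proof
  assume neg: "\<not> starts_positive Z"
  obtain T s where T: "T \<subseteq> Z" "alternating s T" "card T = alternation_number Z"
    by (rule alternation_number_attained[OF assms(1)])
  have "\<not> s"
    using neg T unfolding starts_positive_def by auto
  then show "\<exists>T \<subseteq> Z. alternating False T \<and> card T = alternation_number Z"
    using T by auto
next
  assume "\<exists>T \<subseteq> Z. alternating False T \<and> card T = alternation_number Z"
  then obtain U where "U \<subseteq> Z" "alternating False U" "card U = alternation_number Z"
    by blast
  then show "\<not> starts_positive Z"
    unfolding starts_positive_def using longest_alternating_unique_sign[OF assms] by auto
qed

lemma starts_positive_uminus:
  assumes "finite Z" "antipode_free Z" "Z \<noteq> {}"
  shows "starts_positive (uminus ` Z) \<longleftrightarrow> \<not> starts_positive Z"
proof -
  have "0 \<notin> Z" by (rule antipode_free_zero[OF assms(2)])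
  have sub: "(\<exists>T \<subseteq> uminus ` Z. P T) \<longleftrightarrow> (\<exists>T \<subseteq> Z. P (uminus ` T))" for P
    by (auto simp: subset_image_iff)
  have "starts_positive (uminus ` Z) \<longleftrightarrow>
      (\<exists>T \<subseteq> Z. alternating True (uminus ` T) \<and> card (uminus ` T) = alternation_number Z)"
    unfolding starts_positive_def alternation_number_uminus[OF assms(1,2)] by (rule sub)
  also have "\<dots> \<longleftrightarrow> \<not> starts_positive Z"
  proof -
    have "card (uminus ` T) = card T" for T :: "int set"
      by (simp add: card_image)
    moreover have "alternating True (uminus ` T) = alternating False T" if "T \<subseteq> Z" for T
      using \<open>0 \<notin> Z\<close> that by (subst alternating_uminus) auto
    ultimately show ?thesis
      unfolding not_starts_positive_iff[OF assms] by metis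
  qed
  finally show ?thesis .
qed

text \<open>As the lengths agree, a longest alternating subset of X is also one of Y.\<close>

lemma starts_positive_cong:
  assumes "finite Y" "antipode_free Y" "X \<noteq> {}" "X \<subseteq> Y"
    and "alternation_number X = alternation_number Y"
  shows "starts_positive X \<longleftrightarrow> starts_positive Y"
proof -
  have X: "finite X" "antipode_free X"
    using assms finite_subset antipode_free_subset by blast+
  have "starts_positive X \<Longrightarrow> starts_positive Y"
    unfolding starts_positive_def using assms by (metis subset_trans)
  moreover have "\<not> starts_positive X \<Longrightarrow> \<not> starts_positive Y"
  proof -
    have "Y \<noteq> {}" using assms(3,4) by blast
    then show "\<not> starts_positive X \<Longrightarrow> \<not> starts_positive Y"
      unfolding not_starts_positive_iff[OF X assms(3)] not_starts_positive_iff[OF assms(1,2) \<open>Y \<noteq> {}\<close>]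
      using assms(4,5) by (metis subset_trans)
  qed
  ultimately show ?thesis by blast
qed

section \<open>Alternations of a pair of stable sets\<close>

text \<open>Flipping the signs at odd positions turns ``no two consecutive elements on the same side'' into
  ``no sign change between consecutive positions''.\<close>
definition twist :: "int \<Rightarrow> int" where
  "twist x = (if even x then x else - x)"

definition plus_part :: "int set \<Rightarrow> nat set" where
  "plus_part Z = {i. twist (int i) \<in> Z}"

definition minus_part :: "int set \<Rightarrow> nat set" where
  "minus_part Z = plus_part (uminus ` Z)"

text \<open>Linear, unlike \<open>has_cyclically_consecutive_pair\<close>: the pair {1, n} does not
  count.\<close>

definition has_consecutive :: "nat set \<Rightarrow> bool" where
  "has_consecutive A \<longleftrightarrow> (\<exists>j. {j, Suc j} \<subseteq> A)"

lemma minus_part_iff: "i \<in> minus_part Z \<longleftrightarrow> - twist (int i) \<in> Z"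
  unfolding minus_part_def plus_part_def by (auto intro: rev_image_eqI)

lemma plus_part_uminus: "plus_part (uminus ` Z) = minus_part Z"
  by (simp add: minus_part_def)

lemma minus_part_uminus: "minus_part (uminus ` Z) = plus_part Z"
  by (simp add: minus_part_def image_image)

lemma plus_part_mono: "X \<subseteq> Y \<Longrightarrow> plus_part X \<subseteq> plus_part Y"
  by (auto simp: plus_part_def)

lemma minus_part_mono: "X \<subseteq> Y \<Longrightarrow> minus_part X \<subseteq> minus_part Y"
  unfolding minus_part_def by (intro plus_part_mono) auto

lemma has_consecutive_mono: "has_consecutive A \<Longrightarrow> A \<subseteq> B \<Longrightarrow> has_consecutive B"
  unfolding has_consecutive_def by blast

lemma plus_part_bounds:
  assumes "Z \<subseteq> {- int n..int n}" "antipode_free Z"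
  shows "plus_part Z \<subseteq> {1..n}"
proof
  fix i assume "i \<in> plus_part Z"
  then have "twist (int i) \<in> Z" by (simp add: plus_part_def)
  then have "twist (int i) \<in> {- int n..int n}" "twist (int i) \<noteq> 0"
    using assms(1) antipode_free_zero[OF assms(2)] by (blast, metis)
  then show "i \<in> {1..n}"
    by (auto simp: twist_def split: if_splits)
qed

lemma minus_part_bounds:
  assumes "Z \<subseteq> {- int n..int n}" "antipode_free Z"
  shows "minus_part Z \<subseteq> {1..n}"
  unfolding minus_part_def using assms by (intro plus_part_bounds) auto

lemma plus_minus_disjoint: "antipode_free Z \<Longrightarrow> plus_part Z \<inter> minus_part Z = {}"
  by (auto simp: minus_part_iff plus_part_def antipode_free_def)

lemma twist_nat_abs: "x \<noteq> 0 \<Longrightarrow> twist (int (nat \<bar>x\<bar>)) = (if even x = (0 < x) then x else - x)"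
  by (simp add: twist_def)

lemma in_plus_part:
  assumes "x \<in> Z" "x \<noteq> 0" "even x = (0 < x)"
  shows "nat \<bar>x\<bar> \<in> plus_part Z"
  using assms unfolding plus_part_def mem_Collect_eq twist_nat_abs[OF assms(2)] by simp

lemma in_minus_part:
  assumes "x \<in> Z" "x \<noteq> 0" "even x \<noteq> (0 < x)"
  shows "nat \<bar>x\<bar> \<in> minus_part Z"
  using assms unfolding minus_part_iff twist_nat_abs[OF assms(2)] by simp

lemma card_le_parts:
  assumes "Z \<subseteq> {- int n..int n}" "antipode_free Z"
  shows "card Z \<le> card (plus_part Z) + card (minus_part Z)"
proof -
  have "card Z = card ((\<lambda>x. nat \<bar>x\<bar>) ` Z)"
    using antipode_free_inj_abs[OF assms(2)]
    by (intro card_image[symmetric]) (auto simp: inj_on_def)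
  also have "\<dots> \<le> card (plus_part Z \<union> minus_part Z)"
  proof (rule card_mono)
    show "finite (plus_part Z \<union> minus_part Z)"
      using plus_part_bounds[OF assms] minus_part_bounds[OF assms]
      by (meson finite_Un finite_atLeastAtMost finite_subset)
    have "nat \<bar>x\<bar> \<in> plus_part Z \<union> minus_part Z" if "x \<in> Z" for x
      using in_plus_part[OF that] in_minus_part[OF that] antipode_free_zero[OF assms(2)] that by blast
    then show "(\<lambda>x. nat \<bar>x\<bar>) ` Z \<subseteq> plus_part Z \<union> minus_part Z" by blast
  qed
  also have "\<dots> \<le> card (plus_part Z) + card (minus_part Z)"
    by (rule card_Un_le)
  finally show ?thesis .
qed

section \<open>Alternating sets and blocks of two positions\<close>

text \<open>Positions are grouped into {1, 2}, {3, 4}, ...; this is the number of the group of |x|,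
  starting from 1.\<close>

definition block :: "int \<Rightarrow> nat" where
  "block x = (nat \<bar>x\<bar> + 1) div 2"

context
  fixes n :: nat and Z T :: "int set" and s :: bool
  assumes Z: "Z \<subseteq> {- int n..int n}" "antipode_free Z"
    and stable: "\<not> has_consecutive (plus_part Z)" "\<not> has_consecutive (minus_part Z)"
    and T: "T \<subseteq> Z" "alternating s T"
begin

lemma finite_T: "finite T"
  using Z(1) T(1) by (meson finite_atLeastAtMost_int finite_subset)

lemma inj_abs_T: "inj_on abs T"
  using antipode_free_inj_abs[OF Z(2)] T(1) inj_on_subset by blast

text \<open>Adjacent positions in T have adjacent ranks, hence opposite signs. Their parities differ
  too, so the twist puts both on the same side, contradicting stability.\<close>

lemma stable_alternating_gap:
  assumes x: "x \<in> T" and y: "y \<in> T"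
  shows "\<bar>y\<bar> \<noteq> \<bar>x\<bar> + 1"
proof
  assume eq: "\<bar>y\<bar> = \<bar>x\<bar> + 1"
  have "z = x" if "z \<in> T" "\<bar>x\<bar> \<le> \<bar>z\<bar>" "\<bar>z\<bar> < \<bar>y\<bar>" for z
    using inj_onD[OF inj_abs_T, of z x] that x eq by auto
  then have "{z \<in> T. \<bar>z\<bar> < \<bar>y\<bar>} = insert x {z \<in> T. \<bar>z\<bar> < \<bar>x\<bar>}"
    using x eq by force
  then have "card {z \<in> T. \<bar>z\<bar> < \<bar>y\<bar>} = Suc (card {z \<in> T. \<bar>z\<bar> < \<bar>x\<bar>})"
    using finite_T by simp
  then have sign: "(0 < y) = (\<not> 0 < x)"
  proof -
    have "(0 < z) = (s = even (card {w \<in> T. \<bar>w\<bar> < \<bar>z\<bar>}))" if "z \<in> T" for z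
      using T(2) that unfolding alternating_def by blast
    from this[OF x] this[OF y] show ?thesis
      unfolding \<open>card {z \<in> T. \<bar>z\<bar> < \<bar>y\<bar>} = Suc (card {z \<in> T. \<bar>z\<bar> < \<bar>x\<bar>})\<close> by auto
  qed
  have par: "even y = odd x"
    using eq by presburger
  have suc: "nat \<bar>y\<bar> = Suc (nat \<bar>x\<bar>)"
    using eq by simp
  have mem: "x \<in> Z" "y \<in> Z" "x \<noteq> 0" "y \<noteq> 0"
    using x y T(1) antipode_free_zero[OF Z(2)] by auto
  show False
  proof (cases "even x = (0 < x)")
    case True
    then have "nat \<bar>x\<bar> \<in> plus_part Z" "nat \<bar>y\<bar> \<in> plus_part Z"
      using mem sign par by (intro in_plus_part; blast)+
    then show False
      using stable(1) suc unfolding has_consecutive_def by auto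
  next
    case False
    then have "nat \<bar>x\<bar> \<in> minus_part Z" "nat \<bar>y\<bar> \<in> minus_part Z"
      using mem sign par by (intro in_minus_part; blast)+
    then show False
      using stable(2) suc unfolding has_consecutive_def by auto
  qed
qed

lemma block_eqD:
  assumes "x \<in> T" "y \<in> T" "block x = block y"
  shows "x = y"
proof -
  have "\<bar>x\<bar> = \<bar>y\<bar> \<or> \<bar>x\<bar> = \<bar>y\<bar> + 1 \<or> \<bar>y\<bar> = \<bar>x\<bar> + 1"
    using assms(3) unfolding block_def by linarith
  then show ?thesis
    using stable_alternating_gap assms(1,2) inj_onD[OF inj_abs_T] by blast
qed

lemma block_image: "block ` T \<subseteq> {1..(n + 1) div 2}"
proof
  fix b assume "b \<in> block ` T"
  then obtain x where x: "x \<in> T" "b = block x" by auto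
  then have "x \<noteq> 0" "\<bar>x\<bar> \<le> int n"
    using Z T(1) antipode_free_zero by fastforce+
  then have "1 \<le> nat \<bar>x\<bar>" "nat \<bar>x\<bar> \<le> n" by linarith+
  then show "b \<in> {1..(n + 1) div 2}"
    unfolding x(2) block_def by (simp add: div_le_mono)
qed

text \<open>Each block contains at most one element of T.\<close>

lemma stable_alternating_card: "card T \<le> (n + 1) div 2"
proof -
  have "card T = card (block ` T)"
    using block_eqD by (intro card_image[symmetric]) (auto simp: inj_on_def)
  also have "\<dots> \<le> card {1..(n + 1) div 2}"
    using block_image by (intro card_mono) auto
  finally show ?thesis by simp
qed

text \<open>If every block is hit, the position within the block can only move from left to right, so
  of two consecutive elements of a negatively starting set at least one lies in the plus part.\<close>
lemma stable_alternating_plus_part: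
  assumes s: "\<not> s" and card: "card T = M" and n: "n \<le> 2 * M"
  shows "M div 2 \<le> card (plus_part Z)"
proof -
  have inj: "inj_on block T"
    using block_eqD by (auto simp: inj_on_def)
  \<comment> \<open>As n \<le> 2M, there are at most M blocks, so M elements in different blocks hit
    them all.\<close>
  have "block ` T \<subseteq> {1..M}"
    using block_image n by force
  moreover have "card (block ` T) = M"
    using inj card by (simp add: card_image)
  ultimately have onto: "block ` T = {1..M}"
    by (intro card_subset_eq) auto
  \<comment> \<open>Every block before that of x is hit exactly once, so x has rank
    \<open>block x - 1\<close>, and T starts negatively.\<close>
  have sign: "(0 < x) = even (block x)" if x: "x \<in> T" for x
  proof -
    have less: "(\<bar>y\<bar> < \<bar>x\<bar>) = (block y < block x)" if y: "y \<in> T" for y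
    proof
      assume "\<bar>y\<bar> < \<bar>x\<bar>"
      then have "block y \<le> block x" "y \<noteq> x"
        unfolding block_def by (auto intro!: div_le_mono)
      then show "block y < block x"
        using block_eqD[OF y x] by linarith
    next
      assume "block y < block x"
      moreover have "block x \<le> block y" if "\<bar>x\<bar> \<le> \<bar>y\<bar>"
        unfolding block_def using that by (intro div_le_mono add_le_mono1 nat_mono)
      ultimately show "\<bar>y\<bar> < \<bar>x\<bar>"
        by linarith
    qed
    have "block ` {y \<in> T. \<bar>y\<bar> < \<bar>x\<bar>} = {1..M} \<inter> {..<block x}"
      unfolding onto[symmetric] using less by auto
    also have "\<dots> = {1..<block x}"
    proof -
      have "block x \<in> {1..M}" using onto x by blast
      then show ?thesis by auto
    qed
    finally have "card {y \<in> T. \<bar>y\<bar> < \<bar>x\<bar>} = block x - 1"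
      using card_image[OF inj_on_subset[OF inj, of "{y \<in> T. \<bar>y\<bar> < \<bar>x\<bar>}"]] by simp
    moreover have "1 \<le> block x"
      using onto x by auto
    ultimately show ?thesis
      using T(2) s x unfolding alternating_def by auto
  qed
  \<comment> \<open>Positions 4t - 3, ..., 4t are sent to t and form the blocks 2t - 1 and 2t. Each
    such group contains an element of the plus part.\<close>
  have "{1..M div 2} \<subseteq> (\<lambda>i. (i + 3) div 4) ` plus_part Z"
  proof
    fix t assume t: "t \<in> {1..M div 2}"
    then have "2 * t - 1 \<in> block ` T" "2 * t \<in> block ` T"
      unfolding onto by auto
    then obtain x y where x: "x \<in> T" "block x = 2 * t - 1" and y: "y \<in> T" "block y = 2 * t"
      by (metis imageE)
    have neg: "\<not> 0 < x" and pos: "0 < y"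
      using sign[OF x(1)] sign[OF y(1)] x(2) y(2) t by auto
    show "t \<in> (\<lambda>i. (i + 3) div 4) ` plus_part Z"
    proof (cases "even x")
      case False
      then have "nat \<bar>x\<bar> \<in> plus_part Z"
        using False neg x(1) T(1) by (intro in_plus_part) auto
      moreover have "(nat \<bar>x\<bar> + 3) div 4 = t"
        using x(2) t unfolding block_def by simp
      ultimately show ?thesis by blast
    next
      \<comment> \<open>Here x is negative at position 4t - 2. The gap lemma keeps y away from 4t -
        1, and the positive y at 4t belongs to the plus part.\<close>
      case True
      have "even (nat \<bar>x\<bar>)" using True by (simp add: even_nat_iff)
      moreover have "q = 4 * t - 2" if "even q" "(q + 1) div 2 = 2 * t - 1" "1 \<le> t" for q
        using that by presburger
      ultimately have "nat \<bar>x\<bar> = 4 * t - 2"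
        using x(2) t unfolding block_def by auto
      moreover have "nat \<bar>y\<bar> \<in> {4 * t - 1, 4 * t}"
        using y(2) t unfolding block_def by auto
      moreover have "nat \<bar>y\<bar> \<noteq> nat \<bar>x\<bar> + 1"
        using stable_alternating_gap[OF x(1) y(1)] by linarith
      ultimately have "nat \<bar>y\<bar> = 4 * t"
        using t by auto
      moreover have "y = 4 * int t"
        using pos \<open>nat \<bar>y\<bar> = 4 * t\<close> by linarith
      then have "nat \<bar>y\<bar> \<in> plus_part Z"
        using pos y(1) T(1) by (intro in_plus_part) auto
      ultimately show ?thesis
        by (intro rev_image_eqI[of "nat \<bar>y\<bar>"]) auto
    qed
  qed
  moreover have "finite (plus_part Z)"
    using plus_part_bounds[OF Z] finite_subset by blast
  ultimately show ?thesis
    using surj_card_le[of "plus_part Z" "{1..M div 2}"] by simp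
qed

end

section \<open>Chromatic number\<close>

text \<open>Tucker's lemma with labels split into absolute value and sign: nonzero labels are
  antipodal iff the magnitudes agree and the signs differ.\<close>

lemma tucker_sign_magnitude:
  fixes mag :: "int set \<Rightarrow> nat" and pos :: "int set \<Rightarrow> bool"
  assumes odd: "\<And>X. \<lbrakk>X \<subseteq> {- int n..int n}; antipode_free X; X \<noteq> {}\<rbrakk>
      \<Longrightarrow> mag (uminus ` X) = mag X \<and> pos (uminus ` X) = (\<not> pos X)"
    and same: "\<And>X Y. \<lbrakk>Y \<subseteq> {- int n..int n}; antipode_free Y; X \<noteq> {}; X \<subseteq> Y; mag X = mag Y\<rbrakk>
      \<Longrightarrow> pos X = pos Y"
    and bound: "\<And>X. \<lbrakk>X \<subseteq> {- int n..int n}; antipode_free X; X \<noteq> {}\<rbrakk> \<Longrightarrow> mag X \<in> {1..m}"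
  shows "n \<le> m"
proof (rule octahedral_tucker)
  let ?l = "\<lambda>X. if pos X then int (mag X) else - int (mag X)"
  show "antipodal_labelling n ?l"
  proof
    fix X :: "int set"
    assume "X \<subseteq> {- int n..int n}" "antipode_free X" "X \<noteq> {}"
    then show "?l (uminus ` X) = - ?l X"
      using odd by simp
  next
    fix X Y :: "int set"
    assume XY: "Y \<subseteq> {- int n..int n}" "antipode_free Y" "X \<noteq> {}" "X \<subseteq> Y"
    then have "X \<subseteq> {- int n..int n}" "antipode_free X"
      using antipode_free_subset by blast+
    then have "1 \<le> mag X"
      using bound[of X] XY(3) by simp
    then show "?l X \<noteq> - ?l Y"
      using same[OF XY] by (cases "mag X = mag Y") auto
  qed
  show "\<bar>?l X\<bar> \<le> int m" if "X \<subseteq> {- int n..int n}" "antipode_free X" "X \<noteq> {}" for X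
    using bound[OF that] by simp
qed

text \<open>Think of \<open>col A\<close> as the set of colours of the vertices contained in \<open>A\<close>.\<close>
locale consecutive_colouring =
  fixes n k c :: nat and col :: "nat set \<Rightarrow> nat set"
  assumes k: "2 \<le> k"
    and col_bound: "col A \<subseteq> {..<c}"
    and col_mono: "A \<subseteq> B \<Longrightarrow> col A \<subseteq> col B"
    and col_disjoint: "A \<inter> B = {} \<Longrightarrow> col A \<inter> col B = {}"
    and col_nonempty: "\<lbrakk>A \<subseteq> {1..n}; has_consecutive A; k \<le> card A\<rbrakk> \<Longrightarrow> col A \<noteq> {}"
begin

definition threshold :: nat where
  "threshold = max (2 * k - 2) ((n + 1) div 2)"

definition colours :: "int set \<Rightarrow> nat set" where
  "colours Z = col (plus_part Z) \<union> col (minus_part Z)"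

definition lopsided :: "int set \<Rightarrow> bool" where
  "lopsided Z \<longleftrightarrow> has_consecutive (plus_part Z) \<noteq> has_consecutive (minus_part Z)
     \<and> threshold \<le> alternation_number Z"

text \<open>Colours start at 0, so coloured sets get labels from threshold + 1 to threshold +
  c.\<close>

definition magnitude :: "int set \<Rightarrow> nat" where
  "magnitude Z =
     (if colours Z \<noteq> {} then threshold + 1 + (LEAST i. i \<in> colours Z)
      else if lopsided Z then threshold else alternation_number Z)"

text \<open>Disjoint sides have disjoint colour sets, so the least colour occurs on exactly one
  side, and negation changes the sign.\<close>

definition positive :: "int set \<Rightarrow> bool" where
  "positive Z \<longleftrightarrow>
     (if colours Z \<noteq> {} then (LEAST i. i \<in> colours Z) \<in> col (plus_part Z)
      else if lopsided Z then has_consecutive (plus_part Z) else starts_positive Z)"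

context
  fixes Z :: "int set"
  assumes Z: "Z \<subseteq> {- int n..int n}" "antipode_free Z" "Z \<noteq> {}"
begin

lemma finite_signed: "finite Z"
  using Z(1) by (rule finite_subset) simp

lemma colours_uminus: "colours (uminus ` Z) = colours Z"
  unfolding colours_def plus_part_uminus minus_part_uminus by blast

lemma lopsided_uminus: "lopsided (uminus ` Z) = lopsided Z"
  unfolding lopsided_def plus_part_uminus minus_part_uminus
    alternation_number_uminus[OF finite_signed Z(2)] by blast

lemma magnitude_uminus: "magnitude (uminus ` Z) = magnitude Z"
  by (simp add: magnitude_def colours_uminus lopsided_uminus
      alternation_number_uminus[OF finite_signed Z(2)])

lemma least_colour: "colours Z \<noteq> {} \<Longrightarrow> (LEAST i. i \<in> colours Z) \<in> colours Z"
  using LeastI_ex[of "\<lambda>i. i \<in> colours Z"] by blast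

lemma col_parts_disjoint: "col (plus_part Z) \<inter> col (minus_part Z) = {}"
  by (rule col_disjoint[OF plus_minus_disjoint[OF Z(2)]])

lemma positive_uminus: "positive (uminus ` Z) \<longleftrightarrow> \<not> positive Z"
proof -
  consider (c) "colours Z \<noteq> {}" | (l) "colours Z = {}" "lopsided Z"
    | (s) "colours Z = {}" "\<not> lopsided Z" by blast
  then show ?thesis
  proof cases
    case c
    then show ?thesis
      using least_colour[OF c] col_parts_disjoint
      by (auto simp: positive_def colours_uminus plus_part_uminus) (auto simp: colours_def)
  next
    case l
    then show ?thesis
      by (auto simp: positive_def colours_uminus lopsided_uminus plus_part_uminus)
        (auto simp: lopsided_def)
  next
    case s
    then show ?thesis
      by (simp add: positive_def colours_uminus lopsided_uminus
          starts_positive_uminus[OF finite_signed Z(2,3)])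
  qed
qed

lemma small_part:
  assumes "colours Z = {}"
  shows "has_consecutive (plus_part Z) \<Longrightarrow> card (plus_part Z) < k"
    and "has_consecutive (minus_part Z) \<Longrightarrow> card (minus_part Z) < k"
  using assms col_nonempty[OF plus_part_bounds[OF Z(1,2)]] col_nonempty[OF minus_part_bounds[OF Z(1,2)]]
  unfolding colours_def by fastforce+

text \<open>Each side has at most k - 1 elements; this is the source of the term 2k - 2 in the
  threshold.\<close>

lemma small_support:
  assumes "colours Z = {}" "has_consecutive (plus_part Z)" "has_consecutive (minus_part Z)"
  shows "card Z \<le> threshold"
  using small_part[OF assms(1)] assms(2,3) card_le_parts[OF Z(1,2)] unfolding threshold_def by linarith

lemma magnitude_le_threshold:
  assumes "colours Z = {}"
  shows "magnitude Z \<le> threshold"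
proof (cases "lopsided Z")
  case True
  then show ?thesis using assms by (simp add: magnitude_def)
next
  case False
  have "alternation_number Z \<le> threshold"
  \<comment> \<open>Consecutive elements on both sides bound the support; on neither side, the block
    count gives \<lceil>n/2\<rceil>; on exactly one, not being lopsided is the bound itself.\<close>
  proof (cases "has_consecutive (plus_part Z) = has_consecutive (minus_part Z)")
    case True
    show ?thesis
    proof (cases "has_consecutive (plus_part Z)")
      case True
      then show ?thesis
        using small_support[OF assms] \<open>has_consecutive (plus_part Z) = _\<close>
          alternation_number_le_card[OF finite_signed] by linarith
    next
      case stable: False
      obtain T s where T: "T \<subseteq> Z" "alternating s T" "card T = alternation_number Z"
        by (rule alternation_number_attained[OF finite_signed])
      have "card T \<le> (n + 1) div 2"
        using stable True by (intro stable_alternating_card[OF Z(1,2) _ _ T(1,2)]) auto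
      then show ?thesis
        using T(3) by (simp add: threshold_def)
    qed
  next
    case True: False
    then show ?thesis
      using \<open>\<not> lopsided Z\<close> by (auto simp: lopsided_def)
  qed
  then show ?thesis
    using assms False by (simp add: magnitude_def)
qed

lemma magnitude_range: "magnitude Z \<in> {1..threshold + c}"
proof (cases "colours Z = {}")
  case True
  have "0 < threshold" using k by (simp add: threshold_def)
  then have "0 < magnitude Z"
    using alternation_number_pos[OF finite_signed Z(3)] True by (simp add: magnitude_def)
  then show ?thesis
    using magnitude_le_threshold[OF True] by simp
next
  case False
  then have "(LEAST i. i \<in> colours Z) < c"
    using least_colour col_bound unfolding colours_def by blast
  then show ?thesis
    using False by (simp add: magnitude_def)
qed

text \<open>Hence the side in question cannot acquire consecutive elements while keeping fewer than \<open>k\<close>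
  elements.\<close>
lemma stable_large_parts:
  assumes stable: "\<not> has_consecutive (plus_part Z)" "\<not> has_consecutive (minus_part Z)"
    and alt: "alternation_number Z = threshold"
  shows "\<not> starts_positive Z \<Longrightarrow> k - 1 \<le> card (plus_part Z)"
    and "starts_positive Z \<Longrightarrow> k - 1 \<le> card (minus_part Z)"
proof -
  \<comment> \<open>Each term of the maximum supplies one of the two inequalities.\<close>
  have M: "n \<le> 2 * threshold" "k - 1 \<le> threshold div 2"
    by (auto simp: threshold_def)
  show "k - 1 \<le> card (plus_part Z)" if neg: "\<not> starts_positive Z"
  proof -
    obtain T where T: "T \<subseteq> Z" "alternating False T" "card T = alternation_number Z"
      using neg not_starts_positive_iff[OF finite_signed Z(2,3)] by blast
    have "threshold div 2 \<le> card (plus_part Z)"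
      using T(3) alt M(1) by (intro stable_alternating_plus_part[OF Z(1,2) stable T(1,2)]) auto
    then show ?thesis using M(2) by linarith
  qed
  show "k - 1 \<le> card (minus_part Z)" if "starts_positive Z"
  proof -
    obtain T where T: "T \<subseteq> Z" "alternating True T" "card T = alternation_number Z"
      using \<open>starts_positive Z\<close> unfolding starts_positive_def by blast
    \<comment> \<open>Negation swaps the two parts and reduces this to a set starting
      negatively.\<close>
    have Z': "uminus ` Z \<subseteq> {- int n..int n}" "antipode_free (uminus ` Z)"
      using Z by auto
    have "alternating False (uminus ` T)"
      using T antipode_free_zero[OF Z(2)] by (subst alternating_uminus) auto
    moreover have "uminus ` T \<subseteq> uminus ` Z" using T(1) by blast
    moreover have "card (uminus ` T) = threshold"
      using T(3) alt by (simp add: card_image)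
    ultimately have "threshold div 2 \<le> card (plus_part (uminus ` Z))"
      using stable M(1)
      by (intro stable_alternating_plus_part[OF Z', where s = False and T = "uminus ` T"])
        (simp_all add: plus_part_uminus minus_part_uminus)
    then show ?thesis using M(2) by (simp add: plus_part_uminus)
  qed
qed

end

text \<open>To gain consecutive elements, B has to be larger than A. It then has at least k elements
  and so contains a vertex, hence a colour.\<close>

lemma large_part_stays_stable:
  assumes "A \<subseteq> B" "B \<subseteq> {1..n}" "k - 1 \<le> card A" "\<not> has_consecutive A" "col B = {}"
  shows "\<not> has_consecutive B"
proof
  assume B: "has_consecutive B"
  then have "A \<subset> B" using assms by auto
  then have "card A < card B"
    using assms(2) by (intro psubset_card_mono) (auto intro: finite_subset)
  then have "k \<le> card B" using assms(3) by linarith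
  then show False using col_nonempty[OF assms(2) B] assms(5) by simp
qed

text \<open>The Tucker condition on comparable pairs. If Y is coloured, equal magnitudes force X to
  have the same least colour, on the same side because the sides only grow. The uncoloured cases
  depend on which of X and Y are lopsided.\<close>

lemma positive_cong:
  assumes Y: "Y \<subseteq> {- int n..int n}" "antipode_free Y" and X: "X \<noteq> {}" "X \<subseteq> Y"
    and eq: "magnitude X = magnitude Y"
  shows "positive X = positive Y"
proof -
  have X': "X \<subseteq> {- int n..int n}" "antipode_free X" and "Y \<noteq> {}"
    using X Y antipode_free_subset by blast+
  note ZX = X' X(1) and ZY = Y \<open>Y \<noteq> {}\<close>
  have fin: "finite X" "finite Y"
    using finite_signed[OF ZX] finite_signed[OF ZY] .
  have parts: "plus_part X \<subseteq> plus_part Y" "minus_part X \<subseteq> minus_part Y"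
    using X(2) plus_part_mono minus_part_mono by blast+
  have cons: "has_consecutive (plus_part X) \<Longrightarrow> has_consecutive (plus_part Y)"
    "has_consecutive (minus_part X) \<Longrightarrow> has_consecutive (minus_part Y)"
    using parts has_consecutive_mono by blast+
  have cols: "col (plus_part X) \<subseteq> col (plus_part Y)" "col (minus_part X) \<subseteq> col (minus_part Y)"
    using parts col_mono by blast+
  then have colours: "colours X \<subseteq> colours Y"
    unfolding colours_def by blast
  show ?thesis
  proof (cases "colours Y = {}")
    case False
    have "colours X \<noteq> {}"
    proof
      assume "colours X = {}"
      then have "magnitude X \<le> threshold" by (rule magnitude_le_threshold[OF ZX])
      then show False using eq False by (simp add: magnitude_def)
    qed
    then have "(LEAST i. i \<in> colours X) = (LEAST i. i \<in> colours Y)"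
      using eq False by (simp add: magnitude_def)
    moreover have "(LEAST i. i \<in> colours X) \<in> colours X"
      using least_colour[OF ZX \<open>colours X \<noteq> {}\<close>] .
    ultimately show ?thesis
      using False \<open>colours X \<noteq> {}\<close> cols col_parts_disjoint[OF ZY]
      unfolding positive_def colours_def by auto
  next
    case cY: True
    then have cX: "colours X = {}" using colours by blast
    consider (ll) "lopsided X" "lopsided Y" | (ln) "lopsided X" "\<not> lopsided Y"
      | (nl) "\<not> lopsided X" "lopsided Y" | (nn) "\<not> lopsided X" "\<not> lopsided Y"
      by blast
    then show ?thesis
    proof cases
      case ll
      then show ?thesis
        using cX cY cons unfolding positive_def lopsided_def by auto
    next
      \<comment> \<open>Now Y has consecutive elements on both sides, so |Y| \<le> threshold \<le>
        |X| and the sets coincide.\<close>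
      case ln
      then have "threshold \<le> alternation_number X" "alternation_number Y = threshold"
        using eq cX cY by (auto simp: magnitude_def lopsided_def)
      moreover have "has_consecutive (plus_part Y)" "has_consecutive (minus_part Y)"
        using ln cons \<open>alternation_number Y = threshold\<close> unfolding lopsided_def by auto
      ultimately have "card Y \<le> card X"
        using small_support[OF ZY cY] alternation_number_le_card[OF fin(1)] by linarith
      then have "X = Y"
        using card_seteq[OF fin(2) X(2)] by simp
      then show ?thesis by simp
    next
      \<comment> \<open>X has no consecutive elements on either side. Its starting sign determines a
        side with at least k - 1 elements, which stays stable in Y, so the other side carries the
        consecutive pair of Y.\<close>
      case nl
      then have alt: "alternation_number X = threshold"
        using eq cX cY by (auto simp: magnitude_def)
      have stable: "\<not> has_consecutive (plus_part X)" "\<not> has_consecutive (minus_part X)"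
        using nl alt cons unfolding lopsided_def by auto
      have empty: "col (plus_part Y) = {}" "col (minus_part Y) = {}"
        using cY unfolding colours_def by auto
      have "\<not> starts_positive X \<Longrightarrow> \<not> has_consecutive (plus_part Y)"
        using large_part_stays_stable[OF parts(1) plus_part_bounds[OF Y] _ stable(1) empty(1)]
          stable_large_parts(1)[OF ZX stable alt] by blast
      moreover have "starts_positive X \<Longrightarrow> \<not> has_consecutive (minus_part Y)"
        using large_part_stays_stable[OF parts(2) minus_part_bounds[OF Y] _ stable(2) empty(2)]
          stable_large_parts(2)[OF ZX stable alt] by blast
      ultimately have "starts_positive X = has_consecutive (plus_part Y)"
        using nl unfolding lopsided_def by blast
      then show ?thesis
        using nl cX cY by (simp add: positive_def)
    next
      case nn
      then show ?thesis
        using eq cX cY starts_positive_cong[OF fin(2) Y(2) X]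
        by (simp add: positive_def magnitude_def)
    qed
  qed
qed

lemma ground_set_bound: "n \<le> threshold + c"
proof (rule tucker_sign_magnitude)
  show "magnitude (uminus ` X) = magnitude X \<and> positive (uminus ` X) = (\<not> positive X)"
    if "X \<subseteq> {- int n..int n}" "antipode_free X" "X \<noteq> {}" for X
    using magnitude_uminus[OF that] positive_uminus[OF that] by blast
qed (fact positive_cong magnitude_range)+

end

section \<open>The lower bound\<close>

lemma chromatic_lower_bound:
  assumes col: "proper_coloring (U_graph n k) c f" and k: "2 \<le> k"
  shows "n \<le> max (2 * k - 2) ((n + 1) div 2) + c"
proof -
  let ?V = "pverts (U_graph n k)"
  let ?col = "\<lambda>A. f ` {B \<in> ?V. B \<subseteq> A}"
  interpret consecutive_colouring n k c ?col
  proof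
    show "?col A \<subseteq> {..<c}" for A
      using col unfolding proper_coloring_def by blast
    show "?col A \<subseteq> ?col B" if "A \<subseteq> B" for A B
      using that by blast
    show "?col A \<inter> ?col B = {}" if "A \<inter> B = {}" for A B
    proof -
      have "f A' \<noteq> f B'" if "A' \<in> ?V" "B' \<in> ?V" "A' \<subseteq> A" "B' \<subseteq> B" for A' B'
      proof -
        have "(A', B') \<in> parcs (U_graph n k)"
          using that \<open>A \<inter> B = {}\<close> by (auto simp: U_graph_def)
        then show ?thesis
          using col unfolding proper_coloring_def by blast
      qed
      then show ?thesis by blast
    qed
    show "?col A \<noteq> {}" if A: "A \<subseteq> {1..n}" "has_consecutive A" "k \<le> card A" for A
    proof -
      obtain j where j: "{j, Suc j} \<subseteq> A"
        using A(2) unfolding has_consecutive_def by blast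
      \<comment> \<open>Since 2 \<le> k \<le> |A|, the pair can be padded inside A to a
        vertex.\<close>
      obtain B where B: "{j, Suc j} \<subseteq> B" "B \<subseteq> A" "card B = k"
        using exists_subset_between[of "{j, Suc j}" k A] j A k finite_subset[OF A(1)] by auto
      have "has_cyclically_consecutive_pair n B"
        using B j A(1) unfolding has_cyclically_consecutive_pair_def by (intro disjI1 exI[of _ j]) auto
      then have "B \<in> ?V"
        using B A(1) by (auto simp: U_graph_def)
      then show ?thesis using B(2) by blast
    qed
  qed (rule k)
  show ?thesis
    using ground_set_bound by (simp add: threshold_def)
qed

section \<open>The upper bounds by explicit colourings\<close>

lemma chromatic_number_le:
  assumes "\<And>A. A \<in> pverts (U_graph n k) \<Longrightarrow> f A < c"
    and "\<And>A B. \<lbrakk>A \<in> pverts (U_graph n k); B \<in> pverts (U_graph n k); A \<inter> B = {}\<rbrakk> \<Longrightarrow> f A \<noteq> f B"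
  shows "chromatic_number (U_graph n k) \<le> c"
proof -
  have "proper_coloring (U_graph n k) c f"
    using assms by (auto simp: proper_coloring_def U_graph_def)
  then show ?thesis
    unfolding chromatic_number_def by (intro Least_le) blast
qed

lemma U_graph_vertexD:
  assumes "A \<in> pverts (U_graph n k)"
  shows "A \<subseteq> {1..n}" "card A = k" "finite A" "has_cyclically_consecutive_pair n A" "A \<noteq> {}"
  using assms finite_subset[of A "{1..n}"]
  by (auto simp: U_graph_def has_cyclically_consecutive_pair_def)

text \<open>The standard colouring of Kneser graphs by the least element, with all large values
  merged into the last colour.\<close>

lemma chromatic_number_le_Kneser:
  assumes k: "1 \<le> k" and n: "2 * k \<le> n"
  shows "chromatic_number (U_graph n k) \<le> n - 2 * k + 2"
proof (rule chromatic_number_le[where f = "\<lambda>A. min (Min A - 1) (n - 2 * k + 1)"])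
  fix A B assume A: "A \<in> pverts (U_graph n k)" and B: "B \<in> pverts (U_graph n k)"
    and disj: "A \<inter> B = {}"
  note a = U_graph_vertexD[OF A] and b = U_graph_vertexD[OF B]
  have MinA: "Min A \<in> A" and MinB: "Min B \<in> B"
    using a b by auto
  show "min (Min A - 1) (n - 2 * k + 1) \<noteq> min (Min B - 1) (n - 2 * k + 1)"
  proof
    assume eq: "min (Min A - 1) (n - 2 * k + 1) = min (Min B - 1) (n - 2 * k + 1)"
    have "1 \<le> Min A" "1 \<le> Min B"
      using MinA MinB a(1) b(1) by auto
    moreover have "Min A \<noteq> Min B"
      using MinA MinB disj by auto
    ultimately have "n - 2 * k + 2 \<le> Min A" "n - 2 * k + 2 \<le> Min B"
      using eq by (auto simp: min_def split: if_splits)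
    \<comment> \<open>Two sets with the last colour lie in an interval of 2k - 1 elements, too small
      for disjoint k-sets.\<close>
    then have "A \<union> B \<subseteq> {n - 2 * k + 2..n}"
    proof -
      have "n - 2 * k + 2 \<le> x" "x \<le> n" if "x \<in> A \<union> B" for x
        using that \<open>n - 2 * k + 2 \<le> Min A\<close> \<open>n - 2 * k + 2 \<le> Min B\<close> a(1) b(1)
          Min_le[OF a(3), of x] Min_le[OF b(3), of x] by auto
      then show ?thesis by auto
    qed
    then have "card (A \<union> B) \<le> card {n - 2 * k + 2..n}"
      by (intro card_mono) auto
    moreover have "card (A \<union> B) = 2 * k"
      using a b disj by (simp add: card_Un_disjoint)
    ultimately show False using n k by simp
  qed
qed simp

text \<open>The even numbers, together with 1 if n is odd, form a vertex cover of the cycle.\<close>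
lemma chromatic_number_le_half: "chromatic_number (U_graph n k) \<le> (n + 1) div 2"
proof -
  define g :: "nat set \<Rightarrow> nat" where "g A = (LEAST e. e \<in> A \<and> even e)" for A
  \<comment> \<open>The least even element e gives colour e/2 - 1. A vertex without even elements
    contains 1 and n with n odd, and gets the last colour n div 2.\<close>
  define f where "f A = (if \<exists>e \<in> A. even e then g A div 2 - 1 else n div 2)" for A
  have even: "g A \<in> A" "even (g A)" "f A = g A div 2 - 1" "2 \<le> g A" "g A \<le> n"
    if A: "A \<in> pverts (U_graph n k)" "\<exists>e \<in> A. even e" for A
  proof -
    show *: "g A \<in> A" "even (g A)"
      using LeastI_ex[of "\<lambda>e. e \<in> A \<and> even e"] A(2) by (auto simp: g_def)
    show "f A = g A div 2 - 1" using A(2) by (simp add: f_def)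
    have "1 \<le> g A" "g A \<le> n" "g A \<noteq> 1"
      using * U_graph_vertexD(1)[OF A(1)] by auto
    then show "2 \<le> g A" "g A \<le> n" by linarith+
  qed
  have odd: "1 \<in> A" "odd n" "f A = n div 2"
    if A: "A \<in> pverts (U_graph n k)" "\<not> (\<exists>e \<in> A. even e)" for A
  proof -
    have "\<not> {j, j + 1} \<subseteq> A" for j
      using A(2) by (cases "even j") auto
    then have "{1, n} \<subseteq> A"
      using U_graph_vertexD(4)[OF A(1)] unfolding has_cyclically_consecutive_pair_def by blast
    then show "1 \<in> A" "odd n" using A(2) by auto
    show "f A = n div 2" using A(2) by (simp add: f_def)
  qed
  have less: "f A < n div 2" if A: "A \<in> pverts (U_graph n k)" "\<exists>e \<in> A. even e" for A
    using even(3-5)[OF A] div_le_mono[OF even(5)[OF A], of 2] by linarith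
  show ?thesis
  proof (rule chromatic_number_le[where f = f])
    show "f A < (n + 1) div 2" if A: "A \<in> pverts (U_graph n k)" for A
    proof (cases "\<exists>e \<in> A. even e")
      case True
      then show ?thesis using less[OF A] by linarith
    next
      case False
      then show ?thesis using odd(2,3)[OF A] by (auto elim!: oddE)
    qed
    show "f A \<noteq> f B" if A: "A \<in> pverts (U_graph n k)" and B: "B \<in> pverts (U_graph n k)"
      and disj: "A \<inter> B = {}" for A B
    proof
      assume eq: "f A = f B"
      show False
      proof (cases "\<exists>e \<in> A. even e")
        case eA: True
        then have eB: "\<exists>e \<in> B. even e"
          using odd(3)[OF B] less[OF A] eq by fastforce
        have "g A div 2 = g B div 2"
          using eq even(3,4)[OF A eA] even(3,4)[OF B eB] by linarith
        then have "g A = g B"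
          using even(2)[OF A eA] even(2)[OF B eB] by (metis dvd_div_mult_self)
        then show False
          using even(1)[OF A eA] even(1)[OF B eB] disj by auto
      next
        case eA: False
        then have eB: "\<not> (\<exists>e \<in> B. even e)"
          using odd(3)[OF A] less[OF B] eq by fastforce
        then show False
          using odd(1)[OF A eA] odd(1)[OF B eB] disj by blast
      qed
    qed
  qed
qed

theorem corollary5p5:
  fixes n k :: nat
  assumes "k \<ge> 2" and "n \<ge> 2 * k"
  shows "min (int n - 2 * int k + 2) \<lfloor>real n / 2\<rfloor> \<le> int (chromatic_number (U_graph n k))
    \<and> int (chromatic_number (U_graph n k)) \<le> min (int n - 2 * int k + 2) \<lceil>real n / 2\<rceil>"
proof -
  let ?c = "chromatic_number (U_graph n k)"
  have floor: "\<lfloor>real n / 2\<rfloor> = int (n div 2)"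
    using floor_divide_of_nat_eq[of n 2] by simp
  have ceil: "\<lceil>real n / 2\<rceil> = int ((n + 1) div 2)"
    by linarith
  obtain f where "proper_coloring (U_graph n k) ?c f"
    using chromatic_number_attained[OF pair_graph_U_graph] by blast
  then have "n \<le> max (2 * k - 2) ((n + 1) div 2) + ?c"
    using chromatic_lower_bound assms(1) by blast
  moreover have "?c \<le> n - 2 * k + 2"
    using chromatic_number_le_Kneser assms by simp
  \<comment> \<open>Here n - \<lceil>n/2\<rceil> = \<lfloor>n/2\<rfloor> turns the maximum in the
    lower bound into the stated minimum.\<close>
  ultimately show ?thesis
    unfolding floor ceil using chromatic_number_le_half[of n k] assms by linarith
qed

end
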